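(* $\mathcal{H}_{\mathrm{HP}}$ has $\mathrm{VC}$-dimension $1$, and for all primes $p\geq3$, $\mathcal{H}_{\mathrm{GS}_p}$ has $\mathrm{VC}$-dimension at most $3$.
   Context: A $3$-graph is a pair $H=(V,F)$ with $F\subseteq\binom V3$; $xyz=\{x,y,z\}$; $[n]=\{1,\dots,n\}$. A hereditary $3$-graph property is a class of finite $3$-graphs closed under isomorphism and induced sub-$3$-graphs. The $\mathrm{VC}$-dimension of a graph $(W,E)$ is the largest $k$ for which there are $a_1,\dots,a_k\in W$ and $b_S\in W$ for each $S\subseteq[k]$ with $a_ib_S\in E$ if and only if $i\in S$. For a $3$-graph $H=(V,F)$, $\mathrm{Graph}(H)$ is the bipartite graph with parts $V$ and $\binom V2$ and edges $\{ae:a\in V,e\in\binom V2,\{a\}\cup e\in F\}$; the $\mathrm{VC}$-dimension $\mathrm{VC}(H)$ of $H$ is the $\mathrm{VC}$-dimension of $\mathrm{Graph}(H)$. The $\mathrm{VC}$-dimension of a hereditary $3$-graph property $\mathcal{H}$ is $\max\{\mathrm{VC}(H):H\in\mathcal{H}\}$ (if finite). $\mathrm{HP}(k)$ is the $3$-partite $3$-graph with vertex set $\{a_i,b_i,c_i:i\in[k]\}$ and edge set $\{a_ub_vc_w:u+v+w\geq k+2\}$. $\mathcal{H}_{\mathrm{HP}}$ is the closure of $\{\mathrm{HP}(k):k\geq1\}$ under isomorphism and induced sub-$3$-graphs. $A(p,n)=\{x\in\mathbb{F}_p^n:\exists i\in[n]\text{ with }x_i=1\text{ and }x_j=0\text{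 for all }1\leq j<i\}$. $\mathrm{GS}_p(n)$ is the $3$-partite $3$-graph with vertex set $\{a_g,b_g,c_g:g\in\mathbb{F}_p^n\}$ and edge set $\{a_gb_{g'}c_{g''}:g+g'+g''\in A(p,n)\}$. $\mathcal{H}_{\mathrm{GS}_p}$ is the closure of $\{\mathrm{GS}_p(n):n\geq1\}$ under isomorphism and induced sub-$3$-graphs. *)

theory Defs
  imports
    "HOL-Library.Ramsey"
    "HOL-Library.Extended_Nat"
    "HOL-Library.FuncSet"
    "HOL-Library.Infinite_Typeclass"
    "HOL-Number_Theory.Residues"
begin

text \<open>
  Both graphs and 3-graphs are pairs of a vertex set and a set of edges, each edge being a set of
  vertices. \<open>nsets V k\<close> is the set of \<open>k\<close>-element subsets of \<open>V\<close>.
\<close>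

type_synonym 'v hgraph = "'v set \<times> 'v set set"

abbreviation verts :: "'v hgraph \<Rightarrow> 'v set" where "verts \<equiv> fst"
abbreviation edges :: "'v hgraph \<Rightarrow> 'v set set" where "edges \<equiv> snd"

definition three_graph :: "'v hgraph \<Rightarrow> bool" where
  "three_graph H \<longleftrightarrow> edges H \<subseteq> nsets (verts H) 3"

definition induced_sub :: "'v hgraph \<Rightarrow> 'v set \<Rightarrow> 'v hgraph" where
  "induced_sub H W = (W, {e \<in> edges H. e \<subseteq> W})"

definition isomorphic :: "'v hgraph \<Rightarrow> 'w hgraph \<Rightarrow> bool" where
  "isomorphic G H \<longleftrightarrow>
     (\<exists>f. bij_betw f (verts G) (verts H) \<and> edges H = (\<lambda>e. f ` e) ` edges G)"

text \<open>
  A property is a set of 3-graphs over one vertex type. Over an infinite vertex type every finite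
  3-graph has an isomorphic copy, so that nothing is lost by fixing the type.
\<close>

definition hereditary_property :: "'v hgraph set \<Rightarrow> bool" where
  "hereditary_property P \<longleftrightarrow>
     (\<forall>H\<in>P. three_graph H \<and> finite (verts H)) \<and>
     (\<forall>H\<in>P. \<forall>H'. isomorphic H H' \<longrightarrow> H' \<in> P) \<and>
     (\<forall>H\<in>P. \<forall>W. W \<subseteq> verts H \<longrightarrow> induced_sub H W \<in> P)"

text \<open>
  The members of \<open>\<G>\<close> may live on a vertex type of their own; the closure is the smallest
  hereditary property over the type \<open>'v\<close> that contains all their isomorphic copies.
\<close>

definition hereditary_closure :: "'w hgraph set \<Rightarrow> 'v hgraph set" where
  "hereditary_closure \<G> =
     \<Inter>{P. hereditary_property P \<and> {H. \<exists>G\<in>\<G>. isomorphic G H} \<subseteq> P}"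

definition vc_witness :: "'w hgraph \<Rightarrow> nat \<Rightarrow> (nat \<Rightarrow> 'w) \<Rightarrow> (nat set \<Rightarrow> 'w) \<Rightarrow> bool" where
  "vc_witness G k a b \<longleftrightarrow>
     (\<forall>i\<in>{1..k}. a i \<in> verts G) \<and>
     (\<forall>S. S \<subseteq> {1..k} \<longrightarrow> b S \<in> verts G) \<and>
     (\<forall>i\<in>{1..k}. \<forall>S. S \<subseteq> {1..k} \<longrightarrow> ({a i, b S} \<in> edges G \<longleftrightarrow> i \<in> S))"

text \<open>
  Maxima are taken as suprema in \<open>enat\<close>: a finite supremum of a nonempty set is attained, hence a
  maximum. The graph without vertices, which has no witness even for \<open>k = 0\<close>, gets dimension \<open>0\<close>.
\<close>

definition vc_dim :: "'w hgraph \<Rightarrow> enat" where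
  "vc_dim G = Sup {enat k | k. \<exists>a b. vc_witness G k a b}"

text \<open>The sum type keeps the two parts \<open>V\<close> and \<open>nsets V 2\<close> disjoint.\<close>

definition Graph_of :: "'v hgraph \<Rightarrow> ('v + 'v set) hgraph" where
  "Graph_of H =
     (Inl ` verts H \<union> Inr ` nsets (verts H) 2,
      {{Inl a, Inr e} | a e. a \<in> verts H \<and> e \<in> nsets (verts H) 2 \<and> {a} \<union> e \<in> edges H})"

definition vc_dim3 :: "'v hgraph \<Rightarrow> enat" where
  "vc_dim3 H = vc_dim (Graph_of H)"

definition vc_dim_property :: "'v hgraph set \<Rightarrow> enat" where
  "vc_dim_property P = (SUP H\<in>P. vc_dim3 H)"

text \<open>The three parts: \<open>Va i\<close>, \<open>Vb i\<close>, \<open>Vc i\<close> are the vertices \<open>a\<^sub>i\<close>, \<open>b\<^sub>i\<close>, \<open>c\<^sub>i\<close>.\<close>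

datatype 'i tri_vertex = Va 'i | Vb 'i | Vc 'i

definition HP :: "nat \<Rightarrow> nat tri_vertex hgraph" where
  "HP k =
     (Va ` {1..k} \<union> Vb ` {1..k} \<union> Vc ` {1..k},
      {{Va u, Vb v, Vc w} | u v w.
         u \<in> {1..k} \<and> v \<in> {1..k} \<and> w \<in> {1..k} \<and> u + v + w \<ge> k + 2})"

definition H_HP :: "'v hgraph set" where
  "H_HP = hereditary_closure {HP k | k. k \<ge> 1}"

text \<open>Vectors are extensional functions on \<open>{1..n}\<close> with values in the ring of residues mod \<open>p\<close>.\<close>

definition Fp_vec :: "nat \<Rightarrow> nat \<Rightarrow> (nat \<Rightarrow> int) set" where
  "Fp_vec p n = {1..n} \<rightarrow>\<^sub>E carrier (residue_ring (int p))"

definition vec_add :: "nat \<Rightarrow> nat \<Rightarrow> (nat \<Rightarrow> int) \<Rightarrow> (nat \<Rightarrow> int) \<Rightarrow> (nat \<Rightarrow> int)" where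
  "vec_add p n x y = (\<lambda>i\<in>{1..n}. x i \<oplus>\<^bsub>residue_ring (int p)\<^esub> y i)"

definition A_set :: "nat \<Rightarrow> nat \<Rightarrow> (nat \<Rightarrow> int) set" where
  "A_set p n =
     {x \<in> Fp_vec p n. \<exists>i\<in>{1..n}. x i = \<one>\<^bsub>residue_ring (int p)\<^esub> \<and>
        (\<forall>j\<in>{1..<i}. x j = \<zero>\<^bsub>residue_ring (int p)\<^esub>)}"

definition GS :: "nat \<Rightarrow> nat \<Rightarrow> (nat \<Rightarrow> int) tri_vertex hgraph" where
  "GS p n =
     (Va ` Fp_vec p n \<union> Vb ` Fp_vec p n \<union> Vc ` Fp_vec p n,
      {{Va g, Vb g', Vc g''} | g g' g''.
         g \<in> Fp_vec p n \<and> g' \<in> Fp_vec p n \<and> g'' \<in> Fp_vec p n \<and>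
         vec_add p n (vec_add p n g g') g'' \<in> A_set p n})"

definition H_GS :: "nat \<Rightarrow> 'v hgraph set" where
  "H_GS p = hereditary_closure {GS p n | n. n \<ge> 1}"

end

theory Submission
  imports Defs "HOL-Library.Function_Algebras"
begin

text \<open>
  Both 3-graphs have the form ``\<open>a\<^sub>u b\<^sub>v c\<^sub>w\<close> is an edge iff \<open>u + v + w\<close> satisfies \<open>Q\<close>'' over a
  commutative monoid. If \<open>a\<^sub>1, \<dots>, a\<^sub>k\<close> are shattered, then all \<open>a\<^sub>i\<close> lie in one part (or all are pairs
  missing the same part), because each is adjacent to \<open>b\<^bsub>[k]\<^esub>\<close>; hence the shattering is given by
  weights \<open>x\<^sub>i, y\<^sub>S\<close> with \<open>Q (x\<^sub>i + y\<^sub>S)\<close> iff \<open>i \<in> S\<close>, for \<open>S \<noteq> {}\<close> (the vertex \<open>b\<^bsub>{}\<^esub>\<close> may lie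
  anywhere). For \<open>HP\<close> the weights are linearly ordered and \<open>Q\<close> is upward closed, so \<open>k \<le> 1\<close>.
  For \<open>GS\<close>, let \<open>i\<close> be the first coordinate at which four given \<open>x\<^sub>m\<close> are not all equal. If \<open>S\<close>
  separates them then \<open>x\<^sub>m + y\<^sub>S\<close> vanishes before \<open>i\<close>, so at coordinate \<open>i\<close> the members of \<open>S\<close> have
  sum 0 or 1 and the non-members do not have sum 1. If two of the \<open>x\<^sub>m\<close> agree at \<open>i\<close>, separating them
  forces \<open>y\<^sub>S\<close> at \<open>i\<close> and so decides the membership of a point that differs there; if no two
  agree, no three of them can have sum 0 or 1.
\<close>

section \<open>Embeddings and closures\<close>

text \<open>Induced embeddings cover both isomorphic copies and induced sub-3-graphs, and relate a
  member of a closure to a generator on another vertex type.\<close>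

definition embeds :: "'v hgraph \<Rightarrow> 'w hgraph \<Rightarrow> bool" where
  "embeds H G \<longleftrightarrow> (\<exists>f. inj_on f (verts H) \<and> f ` verts H \<subseteq> verts G \<and>
     (\<forall>e. e \<subseteq> verts H \<longrightarrow> (e \<in> edges H \<longleftrightarrow> f ` e \<in> edges G)))"

lemma embeds_trans:
  assumes "embeds F G" "embeds G H"
  shows "embeds F H"
proof -
  obtain f where f: "inj_on f (verts F)" "f ` verts F \<subseteq> verts G"
    "\<And>e. e \<subseteq> verts F \<Longrightarrow> e \<in> edges F \<longleftrightarrow> f ` e \<in> edges G"
    using assms(1) unfolding embeds_def by blast
  obtain g where g: "inj_on g (verts G)" "g ` verts G \<subseteq> verts H"
    "\<And>e. e \<subseteq> verts G \<Longrightarrow> e \<in> edges G \<longleftrightarrow> g ` e \<in> edges H"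
    using assms(2) unfolding embeds_def by blast
  have "inj_on (g \<circ> f) (verts F)"
    using f g by (meson comp_inj_on inj_on_subset)
  moreover have "(g \<circ> f) ` verts F \<subseteq> verts H"
    using f(2) g(2) by (auto simp: image_subset_iff)
  moreover have "e \<in> edges F \<longleftrightarrow> (g \<circ> f) ` e \<in> edges H" if "e \<subseteq> verts F" for e
  proof -
    have "f ` e \<subseteq> verts G" using that f(2) by blast
    then show ?thesis using f(3)[OF that] g(3) by (simp add: image_comp)
  qed
  ultimately show ?thesis unfolding embeds_def by blast
qed

lemma embeds_induced_sub: "W \<subseteq> verts H \<Longrightarrow> embeds (induced_sub H W) H"
  unfolding embeds_def induced_sub_def by (intro exI[of _ id]) auto

lemma isomorphic_imp_three_graph:
  assumes "isomorphic G H" "three_graph G"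
  shows "three_graph H"
proof -
  obtain f where f: "bij_betw f (verts G) (verts H)" "edges H = (\<lambda>e. f ` e) ` edges G"
    using assms(1) unfolding isomorphic_def by blast
  have "f ` e \<in> nsets (verts H) 3" if "e \<in> edges G" for e
  proof -
    have e: "e \<subseteq> verts G" "finite e" "card e = 3"
      using that assms(2) unfolding three_graph_def nsets_def by auto
    then have "inj_on f e" using f(1) by (meson bij_betw_def inj_on_subset)
    then show ?thesis using e f(1) by (auto simp: nsets_def card_image bij_betw_def)
  qed
  then show ?thesis unfolding three_graph_def f(2) by auto
qed

text \<open>The inverse of the isomorphism is the embedding. \<open>three_graph G\<close> keeps
  edges inside \<open>verts G\<close>: an edge reaching outside could be mapped onto a set of
  vertices of \<open>H\<close> whose preimage is not an edge.\<close>

lemma isomorphic_imp_embeds: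
  assumes "isomorphic G H" "three_graph G"
  shows "embeds H G"
proof -
  obtain f where f: "bij_betw f (verts G) (verts H)" "edges H = (\<lambda>e. f ` e) ` edges G"
    using assms(1) unfolding isomorphic_def by blast
  let ?g = "inv_into (verts G) f"
  have g: "bij_betw ?g (verts H) (verts G)" using f(1) by (rule bij_betw_inv_into)
  have sub: "d \<subseteq> verts G" if "d \<in> edges G" for d
    using that assms(2) unfolding three_graph_def nsets_def by auto
  have "e \<in> edges H \<longleftrightarrow> ?g ` e \<in> edges G" if e: "e \<subseteq> verts H" for e
  proof
    assume "e \<in> edges H"
    then obtain d where d: "d \<in> edges G" "e = f ` d" using f(2) by auto
    have "?g ` e = d"
      using sub[OF d(1)] f(1) d(2) by (metis bij_betw_def inv_into_image_cancel)
    then show "?g ` e \<in> edges G" using d(1) by simp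
  next
    assume "?g ` e \<in> edges G"
    then have "f ` (?g ` e) \<in> edges H" using f(2) by blast
    moreover have "f ` (?g ` e) = e"
      using e f(1) by (metis bij_betw_def image_inv_into_cancel)
    ultimately show "e \<in> edges H" by simp
  qed
  then show ?thesis
    using g unfolding embeds_def by (intro exI[of _ ?g]) (auto simp: bij_betw_def)
qed

text \<open>The finite 3-graphs that embed into some generator form a hereditary property containing
  all copies of generators, so they include the smallest such property.\<close>

lemma hereditary_closure_embeds:
  fixes H :: "'v hgraph" and \<G> :: "'w hgraph set"
  assumes "H \<in> hereditary_closure \<G>"
    and \<G>: "\<And>G. G \<in> \<G> \<Longrightarrow> three_graph G \<and> finite (verts G)"
  obtains G where "G \<in> \<G>" "embeds H G"
proof -
  let ?P = "{H :: 'v hgraph. three_graph H \<and> finite (verts H) \<and> (\<exists>G\<in>\<G>. embeds H G)}"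
  have fin: "finite (verts H')" if "isomorphic H H'" "finite (verts H)"
    for H :: "'x hgraph" and H' :: "'y hgraph"
    using that unfolding isomorphic_def by (metis bij_betw_finite)
  have "hereditary_property ?P"
    unfolding hereditary_property_def
  proof (intro conjI ballI allI impI)
    fix H :: "'v hgraph" and W assume "H \<in> ?P" "W \<subseteq> verts H"
    moreover from this have "three_graph (induced_sub H W)" "finite (verts (induced_sub H W))"
      by (auto simp: three_graph_def induced_sub_def nsets_def intro: finite_subset)
    ultimately show "induced_sub H W \<in> ?P"
      using embeds_induced_sub embeds_trans by blast
  next
    fix H H' :: "'v hgraph" assume "H \<in> ?P" "isomorphic H H'"
    then show "H' \<in> ?P"
      using isomorphic_imp_three_graph isomorphic_imp_embeds embeds_trans fin by blast
  qed auto
  moreover have "{H. \<exists>G\<in>\<G>. isomorphic G H} \<subseteq> ?P"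
    using \<G> isomorphic_imp_three_graph isomorphic_imp_embeds fin by blast
  ultimately have "hereditary_closure \<G> \<subseteq> ?P"
    unfolding hereditary_closure_def by blast
  then show thesis using assms(1) that by blast
qed

lemma isomorphic_in_hereditary_closure:
  "G \<in> \<G> \<Longrightarrow> isomorphic G H \<Longrightarrow> H \<in> hereditary_closure \<G>"
  unfolding hereditary_closure_def by blast

section \<open>VC-dimension\<close>

lemma Graph_of_edge_simps:
  "{Inl a, Inr e} \<in> edges (Graph_of H) \<longleftrightarrow>
     a \<in> verts H \<and> e \<in> nsets (verts H) 2 \<and> insert a e \<in> edges H"
  "{Inr e, Inl a} \<in> edges (Graph_of H) \<longleftrightarrow>
     a \<in> verts H \<and> e \<in> nsets (verts H) 2 \<and> insert a e \<in> edges H"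
  "{Inl a, Inl a'} \<notin> edges (Graph_of H)"
  "{Inr e, Inr e'} \<notin> edges (Graph_of H)"
  unfolding Graph_of_def by (auto simp: doubleton_eq_iff)

lemma Graph_of_verts_simps:
  "Inl a \<in> verts (Graph_of H) \<longleftrightarrow> a \<in> verts H"
  "Inr e \<in> verts (Graph_of H) \<longleftrightarrow> e \<in> nsets (verts H) 2"
  unfolding Graph_of_def by auto

text \<open>An induced embedding acts on vertices and on pairs at once, preserving adjacency and
  non-adjacency in the bipartite graph.\<close>

lemma vc_witness_Graph_of_embeds:
  assumes "embeds H G" "vc_witness (Graph_of H) k a b"
  obtains a' b' where "vc_witness (Graph_of G) k a' b'"
proof -
  obtain f where f: "inj_on f (verts H)" "f ` verts H \<subseteq> verts G"
    "\<And>e. e \<subseteq> verts H \<Longrightarrow> e \<in> edges H \<longleftrightarrow> f ` e \<in> edges G"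
    using assms(1) unfolding embeds_def by blast
  let ?\<phi> = "map_sum f (image f)"
  have pair: "f ` e \<in> nsets (verts G) 2" if "e \<in> nsets (verts H) 2" for e
    using that f(1,2) by (auto simp: nsets_def card_image inj_on_subset)
  have v: "?\<phi> x \<in> verts (Graph_of G)" if "x \<in> verts (Graph_of H)" for x
    using that f(2) pair by (cases x) (auto simp: Graph_of_verts_simps)
  have ins: "insert a e \<in> edges H \<longleftrightarrow> insert (f a) (f ` e) \<in> edges G"
    if "a \<in> verts H" "e \<in> nsets (verts H) 2" for a e
    using f(3)[of "insert a e"] that by (auto simp: nsets_def)
  have e: "{?\<phi> x, ?\<phi> y} \<in> edges (Graph_of G) \<longleftrightarrow> {x, y} \<in> edges (Graph_of H)"
    if "x \<in> verts (Graph_of H)" "y \<in> verts (Graph_of H)" for x y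
    using that f(2) pair ins
    by (cases x; cases y) (auto simp: Graph_of_verts_simps Graph_of_edge_simps)
  have "vc_witness (Graph_of G) k (?\<phi> \<circ> a) (?\<phi> \<circ> b)"
    using assms(2) v e unfolding vc_witness_def by simp
  then show thesis by (rule that)
qed

text \<open>Reduces an upper bound for the closure to its generators.\<close>

lemma vc_dim_property_closure_le:
  fixes \<G> :: "'w hgraph set"
  assumes \<G>: "\<And>G. G \<in> \<G> \<Longrightarrow> three_graph G \<and> finite (verts G)"
    and bound: "\<And>G k a b. G \<in> \<G> \<Longrightarrow> vc_witness (Graph_of G) k a b \<Longrightarrow> k \<le> d"
  shows "vc_dim_property (hereditary_closure \<G> :: 'v hgraph set) \<le> enat d"
  unfolding vc_dim_property_def
proof (rule SUP_least)
  fix H :: "'v hgraph" assume "H \<in> hereditary_closure \<G>"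
  then obtain G where G: "G \<in> \<G>" "embeds H G"
    using \<G> by (rule hereditary_closure_embeds)
  have "k \<le> d" if "vc_witness (Graph_of H) k a b" for k a b
    using vc_witness_Graph_of_embeds[OF G(2) that] bound[OF G(1)] by blast
  then show "vc_dim3 H \<le> enat d"
    unfolding vc_dim3_def vc_dim_def by (auto intro!: Sup_least)
qed

section \<open>Tripartite 3-graphs defined by a sum\<close>

text \<open>The sum is formed in the ambient monoid and may leave \<open>X\<close>: natural numbers
  for \<open>HP\<close>, integer-valued functions under pointwise addition for
  \<open>GS\<close>.\<close>

definition sum_graph :: "'i set \<Rightarrow> ('i::comm_monoid_add \<Rightarrow> bool) \<Rightarrow> 'i tri_vertex hgraph" where
  "sum_graph X Q =
     (Va ` X \<union> Vb ` X \<union> Vc ` X,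
      {{Va u, Vb v, Vc w} | u v w. u \<in> X \<and> v \<in> X \<and> w \<in> X \<and> Q (u + v + w)})"

primrec weight :: "'i tri_vertex \<Rightarrow> 'i" where
  "weight (Va u) = u" | "weight (Vb u) = u" | "weight (Vc u) = u"

abbreviation part :: "'i tri_vertex \<Rightarrow> unit tri_vertex" where
  "part \<equiv> map_tri_vertex (\<lambda>_. ())"

lemma UNIV_unit_tri_vertex: "(UNIV :: unit tri_vertex set) = {Va (), Vb (), Vc ()}"
proof -
  have "x \<in> {Va (), Vb (), Vc ()}" for x :: "unit tri_vertex" by (cases x) auto
  then show ?thesis by blast
qed

lemma three_graph_sum_graph: "three_graph (sum_graph X Q)"
  unfolding three_graph_def sum_graph_def nsets_def by auto

lemma finite_verts_sum_graph: "finite X \<Longrightarrow> finite (verts (sum_graph X Q))"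
  unfolding sum_graph_def by simp

text \<open>Splits adjacency into a matching of parts, saying that \<open>e\<close> meets exactly
  the two parts other than that of \<open>a\<close>, and a condition on the weights alone.\<close>

lemma sum_graph_edge_iff:
  assumes a: "a \<in> verts (sum_graph X Q)" and e: "e \<in> nsets (verts (sum_graph X Q)) 2"
  shows "insert a e \<in> edges (sum_graph X Q) \<longleftrightarrow>
    - part ` e = {part a} \<and> Q (weight a + sum weight e)"
proof -
  obtain x y where xy: "e = {x, y}" "x \<noteq> y"
    using e by (auto simp: nsets_def card_2_iff)
  have compl: "- part ` e = {part a} \<longleftrightarrow>
      part a \<notin> {part x, part y} \<and> UNIV = {part a, part x, part y}"
    unfolding xy by auto
  have mem: "weight z \<in> X" if "z \<in> verts (sum_graph X Q)" for z
    using that by (auto simp: sum_graph_def)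
  have X: "weight a \<in> X" "weight x \<in> X" "weight y \<in> X"
    using a e mem unfolding xy nsets_def by auto
  have triple: "{Va u, Vb v, Vc w} \<in> edges (sum_graph X Q) \<longleftrightarrow>
      u \<in> X \<and> v \<in> X \<and> w \<in> X \<and> Q (u + v + w)" for u v w
    unfolding sum_graph_def by (auto simp: insert_eq_iff)
  have all_parts: "UNIV = part ` E" if "E \<in> edges (sum_graph X Q)" for E
    using that unfolding sum_graph_def UNIV_unit_tri_vertex by auto
  \<comment> \<open>The five other orders of the three parts are brought to the order in which
    \<open>triple\<close> applies.\<close>
  have perms:
    "{Va u, Vc w, Vb v} = {Va u, Vb v, Vc w}" "{Vb v, Va u, Vc w} = {Va u, Vb v, Vc w}"
    "{Vb v, Vc w, Va u} = {Va u, Vb v, Vc w}" "{Vc w, Va u, Vb v} = {Va u, Vb v, Vc w}"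
    "{Vc w, Vb v, Va u} = {Va u, Vb v, Vc w}" for u v w :: 'a
    by blast+
  show ?thesis
  proof (cases "UNIV = {part a, part x, part y}")
    case False
    then have "insert a e \<notin> edges (sum_graph X Q)" using all_parts xy by fastforce
    then show ?thesis using False compl by blast
  next
    case True
    then have all: "Va () \<in> {part a, part x, part y}" "Vb () \<in> {part a, part x, part y}"
      "Vc () \<in> {part a, part x, part y}"
      by blast+
    have "insert a e \<in> edges (sum_graph X Q) \<longleftrightarrow>
        part a \<notin> {part x, part y} \<and> Q (weight a + (weight x + weight y))"
      using X all unfolding xy(1)
      by (cases a; cases x; cases y) (simp_all add: perms triple add_ac)
    moreover have "sum weight e = weight x + weight y" using xy by simp
    ultimately show ?thesis using True compl by simp
  qed
qed

lemma vc_witness_sum_graph: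
  assumes wit: "vc_witness (Graph_of (sum_graph X Q)) k a b"
  obtains x y where
    "\<And>i S. i \<in> {1..k} \<Longrightarrow> S \<subseteq> {1..k} \<Longrightarrow> S \<noteq> {} \<Longrightarrow> Q (x i + y S) \<longleftrightarrow> i \<in> S"
proof -
  let ?B = "Graph_of (sum_graph X Q)"
  \<comment> \<open>A vertex is labelled by its part and a pair by the parts it misses, so that
    adjacent elements carry equal labels.\<close>
  define lab where "lab = case_sum (\<lambda>v::'a tri_vertex. {part v}) (\<lambda>e::'a tri_vertex set. - part ` e)"
  define wt where "wt = case_sum weight (sum (weight :: 'a tri_vertex \<Rightarrow> 'a))"
  have edge: "{s, t} \<in> edges ?B \<longleftrightarrow> isl s \<noteq> isl t \<and> lab s = lab t \<and> Q (wt s + wt t)"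
    if "s \<in> verts ?B" "t \<in> verts ?B" for s t
    using that sum_graph_edge_iff[of _ X Q]
    by (cases s; cases t)
      (auto simp: Graph_of_verts_simps Graph_of_edge_simps lab_def wt_def add.commute)
  have av: "a i \<in> verts ?B" if "i \<in> {1..k}" for i
    using wit that unfolding vc_witness_def by blast
  have bv: "b S \<in> verts ?B" if "S \<subseteq> {1..k}" for S
    using wit that unfolding vc_witness_def by blast
  have ab: "{a i, b S} \<in> edges ?B \<longleftrightarrow> i \<in> S" if "i \<in> {1..k}" "S \<subseteq> {1..k}" for i S
    using wit that unfolding vc_witness_def by blast
  have "Q (wt (a i) + wt (b S)) \<longleftrightarrow> i \<in> S"
    if i: "i \<in> {1..k}" and S: "S \<subseteq> {1..k}" and ne: "S \<noteq> {}" for i S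
  proof -
    \<comment> \<open>All \<open>a m\<close> share the side and label compatible with
      \<open>b {1..k}\<close>. Since \<open>b S\<close> is compatible with \<open>a j\<close>, it is
      compatible with every \<open>a i\<close>, and only \<open>Q\<close> decides adjacency.\<close>
    obtain j where j: "j \<in> S" using ne by blast
    then have jk: "j \<in> {1..k}" using S by blast
    have "isl (a m) \<noteq> isl (b {1..k}) \<and> lab (a m) = lab (b {1..k})" if "m \<in> {1..k}" for m
      using ab[OF that order_refl] edge[OF av[OF that] bv[OF order_refl]] that by blast
    moreover have "isl (a j) \<noteq> isl (b S) \<and> lab (a j) = lab (b S)"
      using ab[OF jk S] edge[OF av[OF jk] bv[OF S]] j by blast
    ultimately have "isl (a i) \<noteq> isl (b S) \<and> lab (a i) = lab (b S)"
      using i jk by metis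
    then show ?thesis using ab[OF i S] edge[OF av[OF i] bv[OF S]] by blast
  qed
  then show thesis by (rule that[of "wt \<circ> a" "wt \<circ> b", unfolded comp_def])
qed

section \<open>The 3-graphs \<open>HP(k)\<close>\<close>

lemma HP_eq_sum_graph: "HP k = sum_graph {1..k} (\<lambda>s. s \<ge> k + 2)"
  unfolding HP_def sum_graph_def by simp

text \<open>With a threshold, the set \<open>{1}\<close> forces \<open>x 1 > x 2\<close> and the set
  \<open>{2}\<close> forces the reverse.\<close>

lemma vc_witness_HP_le:
  assumes "vc_witness (Graph_of (HP n)) k a b"
  shows "k \<le> 1"
proof (rule ccontr)
  assume "\<not> k \<le> 1"
  then have k: "1 \<in> {1..k}" "2 \<in> {1..k}" "{1} \<subseteq> {1..k}" "{2} \<subseteq> {1..k}" by auto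
  obtain x y where xy:
    "\<And>i S. i \<in> {1..k} \<Longrightarrow> S \<subseteq> {1..k} \<Longrightarrow> S \<noteq> {} \<Longrightarrow> n + 2 \<le> x i + y S \<longleftrightarrow> i \<in> S"
    using vc_witness_sum_graph[OF assms[unfolded HP_eq_sum_graph]] by blast
  have "n + 2 \<le> x 1 + y {1}" "\<not> n + 2 \<le> x 2 + y {1}"
    "\<not> n + 2 \<le> x 1 + y {2}" "n + 2 \<le> x 2 + y {2}"
    using xy[of 1 "{1}"] xy[of 2 "{1}"] xy[of 1 "{2}"] xy[of 2 "{2}"] k by auto
  then show False by linarith
qed

lemma vc_dim_property_H_HP: "vc_dim_property (H_HP :: 'v::infinite hgraph set) = 1"
proof (rule antisym)
  show "vc_dim_property (H_HP :: 'v hgraph set) \<le> 1"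
    unfolding H_HP_def one_enat_def
  proof (rule vc_dim_property_closure_le)
    fix G assume "G \<in> {HP n |n. n \<ge> 1}"
    then obtain n where G: "G = HP n" by blast
    show "three_graph G \<and> finite (verts G)"
      unfolding G HP_eq_sum_graph by (simp add: three_graph_sum_graph finite_verts_sum_graph)
    show "k \<le> 1" if "vc_witness (Graph_of G) k a b" for k a b
      using vc_witness_HP_le[OF that[unfolded G]] .
  qed
next
  \<comment> \<open>For the lower bound, \<open>HP 1\<close>, which is a single edge, is copied into
    the infinite type \<open>'v\<close>.\<close>
  have fin: "finite (verts (HP 1))"
    unfolding HP_eq_sum_graph by (rule finite_verts_sum_graph) simp
  obtain V :: "'v set" where V: "finite V" "card V = card (verts (HP 1))"
    using infinite_arbitrarily_large[OF infinite_UNIV, of "card (verts (HP 1))"] by auto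
  then obtain f where f: "bij_betw f (verts (HP 1)) V"
    using finite_same_card_bij fin by metis
  define H where "H = (V, (\<lambda>e. f ` e) ` edges (HP 1))"
  have "isomorphic (HP 1) H" unfolding isomorphic_def H_def using f by auto
  then have H: "H \<in> H_HP"
    unfolding H_HP_def by (intro isomorphic_in_hereditary_closure) auto
  let ?u = "f (Va 1)" and ?e = "{f (Vb 1), f (Vc 1)}"
  have "verts (HP 1) = {Va 1, Vb 1, Vc 1}" unfolding HP_def by auto
  then have ue: "?u \<in> verts H" "?e \<in> nsets (verts H) 2"
    using f unfolding H_def bij_betw_def nsets_def by auto
  have "{Va 1, Vb 1, Vc 1} \<in> edges (HP 1)" unfolding HP_def by auto
  then have "f ` {Va 1, Vb 1, Vc 1} \<in> edges H"
    unfolding H_def snd_conv by (rule imageI)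
  then have edge: "{Inl ?u, Inr ?e} \<in> edges (Graph_of H)"
    using ue by (simp add: Graph_of_edge_simps)
  have non_edge: "{Inl ?u, Inl ?u} \<notin> edges (Graph_of H)"
    by (rule Graph_of_edge_simps)
  have "Inl ?u \<in> verts (Graph_of H)" "Inr ?e \<in> verts (Graph_of H)"
    using ue by (simp_all add: Graph_of_verts_simps)
  \<comment> \<open>The empty set is represented by \<open>Inl ?u\<close> itself, which lies on the
    same side as the shattered point and so is not adjacent to it.\<close>
  then have "vc_witness (Graph_of H) 1 (\<lambda>_. Inl ?u) (\<lambda>S. if 1 \<in> S then Inr ?e else Inl ?u)"
    using edge non_edge unfolding vc_witness_def by simp
  then have "enat 1 \<le> vc_dim3 H"
    unfolding vc_dim3_def vc_dim_def by (intro Sup_upper) blast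
  also have "\<dots> \<le> vc_dim_property (H_HP :: 'v hgraph set)"
    unfolding vc_dim_property_def using H by (rule SUP_upper)
  finally show "1 \<le> vc_dim_property (H_HP :: 'v hgraph set)" by (simp add: one_enat_def)
qed

section \<open>The Green--Sanders 3-graphs\<close>

text \<open>\<open>A_set\<close> read on integer-valued functions through their residues, so that
  vectors can be added pointwise without reduction.\<close>

definition leading_one :: "nat \<Rightarrow> nat \<Rightarrow> (nat \<Rightarrow> int) \<Rightarrow> bool" where
  "leading_one p n s \<longleftrightarrow>
     (\<exists>i\<in>{1..n}. s i mod int p = 1 \<and> (\<forall>j\<in>{1..<i}. s j mod int p = 0))"

lemma leading_one_cong:
  assumes "\<And>i. i \<in> {1..n} \<Longrightarrow> s i mod int p = t i mod int p"
  shows "leading_one p n s \<longleftrightarrow> leading_one p n t"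
  unfolding leading_one_def using assms by (intro bex_cong) auto

text \<open>The first coordinate with nonzero residue decides: a leading one can only stand
  there.\<close>

lemma leading_one_iff:
  assumes "j \<in> {1..n}" "\<And>l. l \<in> {1..<j} \<Longrightarrow> s l mod int p = 0" "s j mod int p \<noteq> 0"
  shows "leading_one p n s \<longleftrightarrow> s j mod int p = 1"
proof
  assume "leading_one p n s"
  then obtain i where i: "i \<in> {1..n}" "s i mod int p = 1" "\<forall>j\<in>{1..<i}. s j mod int p = 0"
    unfolding leading_one_def by blast
  have "i = j" using i assms by (metis atLeastAtMost_iff atLeastLessThan_iff linorder_neqE_nat zero_neq_one)
  then show "s j mod int p = 1" using i by simp
qed (use assms leading_one_def in blast)

lemma GS_eq_sum_graph:
  assumes "p \<ge> 1"
  shows "GS p n = sum_graph (Fp_vec p n) (leading_one p n)"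
proof -
  have "vec_add p n (vec_add p n g g') g'' \<in> A_set p n \<longleftrightarrow> leading_one p n (g + g' + g'')"
    for g g' g''
  proof -
    let ?s = "vec_add p n (vec_add p n g g') g''"
    have s: "?s i = (g + g' + g'') i mod int p" if "i \<in> {1..n}" for i
      using that by (simp add: vec_add_def residue_ring_def mod_simps)
    \<comment> \<open>Here \<open>p \<ge> 1\<close> ensures that reduction lands in the
      carrier.\<close>
    have "?s \<in> Fp_vec p n"
      using assms unfolding Fp_vec_def vec_add_def residue_ring_def by auto
    then have "?s \<in> A_set p n \<longleftrightarrow> (\<exists>i\<in>{1..n}. ?s i = 1 \<and> (\<forall>j\<in>{1..<i}. ?s j = 0))"
      unfolding A_set_def by (simp add: residue_ring_def)
    also have "\<dots> \<longleftrightarrow> leading_one p n (g + g' + g'')"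
      unfolding leading_one_def by (intro bex_cong refl conj_cong ball_cong) (auto simp: s)
    finally show ?thesis .
  qed
  then show ?thesis unfolding GS_def sum_graph_def by simp
qed

lemma finite_Fp_vec: "finite (Fp_vec p n)"
  unfolding Fp_vec_def residue_ring_def by (intro finite_PiE) auto

text \<open>What shattering leaves at the first coordinate that distinguishes the four points: a
  member with sum 0 is decided later, hence \<open>{0, 1}\<close> in \<open>mem\<close>. The full
  set is excluded because a common earlier coordinate may decide it.\<close>

lemma shattered_residues_False:
  fixes t :: "nat \<Rightarrow> int" and c :: "nat set \<Rightarrow> int"
  assumes neq: "m\<^sub>1 \<in> {1..4}" "m\<^sub>2 \<in> {1..4}" "t m\<^sub>1 mod q \<noteq> t m\<^sub>2 mod q"
    and mem: "\<And>S m. S \<subset> {1..4} \<Longrightarrow> m \<in> S \<Longrightarrow> (t m + c S) mod q \<in> {0, 1}"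
    and nmem: "\<And>S m. S \<subset> {1..4} \<Longrightarrow> S \<noteq> {} \<Longrightarrow> m \<in> {1..4} - S \<Longrightarrow> (t m + c S) mod q \<noteq> 1"
  shows False
proof -
  have cancel: "(t m + d) mod q = (t m' + d) mod q \<longleftrightarrow> t m mod q = t m' mod q" for m m' d
    by (simp add: mod_eq_dvd_iff)
  show False
  proof (cases "inj_on (\<lambda>m. t m mod q) {1..4}")
    case True
    have "{1, 2, 3} \<subset> {1..4::nat}" by auto
    then have "(t m + c {1, 2, 3}) mod q \<in> {0, 1}" if "m \<in> {1, 2, 3}" for m
      using mem that by blast
    \<comment> \<open>Three sums take only two values, so two of them coincide.\<close>
    from this[of 1] this[of 2] this[of 3]
    have "t 1 mod q = t 2 mod q \<or> t 1 mod q = t 3 mod q \<or> t 2 mod q = t 3 mod q"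
      unfolding cancel[of _ "c {1, 2, 3}", symmetric] by auto
    then show False
      using inj_onD[OF True, of 1 2] inj_onD[OF True, of 1 3] inj_onD[OF True, of 2 3] by auto
  next
    case False
    then obtain a b where ab: "a \<in> {1..4}" "b \<in> {1..4}" "a \<noteq> b" "t a mod q = t b mod q"
      unfolding inj_on_def by blast
    obtain m where m: "m \<in> {1..4}" "t m mod q \<noteq> t a mod q" using neq by metis
    have mb: "m \<noteq> b" "m \<noteq> a" using m ab by auto
    have sub: "{a} \<subset> {1..4}" "{a, m} \<subset> {1..4}"
      using ab(1-3) m(1) mb unfolding psubset_eq by (metis empty_subsetI insert_iff insert_subset singletonD)+
    \<comment> \<open>The points \<open>a\<close> and \<open>b\<close> always have equal sums; as
      \<open>b\<close> is outside \<open>S\<close>, the value 1 is ruled out for both.\<close>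
    have zero: "(t a + c S) mod q = 0" if "S \<subset> {1..4}" "a \<in> S" "b \<notin> S" for S
    proof -
      have "(t b + c S) mod q \<noteq> 1" using nmem[OF that(1), of b] that ab(2) by blast
      moreover have "(t a + c S) mod q = (t b + c S) mod q" using cancel ab(4) by blast
      ultimately show ?thesis using mem[OF that(1,2)] by force
    qed
    have z: "(t a + c {a}) mod q = 0" "(t a + c {a, m}) mod q = 0"
      using zero[OF sub(1)] zero[OF sub(2)] ab(3) mb by blast+
    \<comment> \<open>Thus \<open>c {a}\<close> and \<open>c {a, m}\<close> are congruent, although
      only the second set contains \<open>m\<close>.\<close>
    then have "(t a + c {a}) mod q = (t a + c {a, m}) mod q" by (simp only:)
    then have "(t m + c {a}) mod q = (t m + c {a, m}) mod q"
      by (simp only: mod_eq_dvd_iff add_diff_cancel_left)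
    moreover have "(t m + c {a, m}) mod q = 1"
    proof -
      have "(t m + c {a, m}) mod q \<noteq> 0" using z(2) m(2) cancel by metis
      then show ?thesis using mem[OF sub(2), of m] by blast
    qed
    moreover have "(t m + c {a}) mod q \<noteq> 1"
      using nmem[OF sub(1), of m] m(1) mb by blast
    ultimately show False by simp
  qed
qed

lemma leading_one_not_shatters_4:
  fixes x :: "nat \<Rightarrow> nat \<Rightarrow> int" and y :: "nat set \<Rightarrow> nat \<Rightarrow> int"
  assumes sh: "\<And>i S. i \<in> {1..4} \<Longrightarrow> S \<subseteq> {1..4} \<Longrightarrow> S \<noteq> {} \<Longrightarrow>
    leading_one p n (x i + y S) \<longleftrightarrow> i \<in> S"
  shows False
proof -
  have add_cong: "(x m + y S) j mod int p = (x m' + y S) j mod int p"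
    if "x m j mod int p = x m' j mod int p" for m m' S j
    using mod_add_cong[OF that refl, of "y S j"] by (simp only: plus_fun_apply)
  \<comment> \<open>Comparison with \<open>x 1\<close> suffices to detect that the four points are
    not all equal at a coordinate.\<close>
  define D where "D i \<longleftrightarrow> i \<in> {1..n} \<and> (\<exists>m\<in>{1..4}. x m i mod int p \<noteq> x 1 i mod int p)" for i
  have "\<exists>i. D i"
  proof (rule ccontr)
    assume "\<nexists>i. D i"
    then have eq: "x 2 i mod int p = x 1 i mod int p" if "i \<in> {1..n}" for i
    proof -
      have "(2::nat) \<in> {1..4}" by simp
      then show ?thesis using \<open>\<nexists>i. D i\<close> that unfolding D_def by blast
    qed
    have "leading_one p n (x 2 + y {1}) \<longleftrightarrow> leading_one p n (x 1 + y {1})"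
      by (rule leading_one_cong) (rule add_cong[OF eq])
    moreover have "leading_one p n (x 1 + y {1})" "\<not> leading_one p n (x 2 + y {1})"
      using sh[of 1 "{1}"] sh[of 2 "{1}"] by simp_all
    ultimately show False by blast
  qed
  define i where "i = (LEAST i. D i)"
  have Di: "D i" unfolding i_def using \<open>\<exists>i. D i\<close> by (rule LeastI_ex)
  then have i: "i \<in> {1..n}" unfolding D_def by blast
  have agree: "x m j mod int p = x 1 j mod int p" if "m \<in> {1..4}" "j \<in> {1..<i}" for m j
  proof -
    have "\<not> D j" using not_less_Least[of j D] that(2) unfolding i_def[symmetric] by simp
    moreover have "j \<in> {1..n}" using that(2) i by simp
    ultimately show ?thesis using that(1) unfolding D_def by blast
  qed
  have agree_sum: "(x m + y S) j mod int p = (x 1 + y S) j mod int p"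
    if "m \<in> {1..4}" "j \<in> {1..<i}" for m j S
    using agree[OF that] by (rule add_cong)
  \<comment> \<open>Otherwise the first nonzero coordinate \<open>l\<close> before \<open>i\<close>
    would be common to all four points and decide them alike, making \<open>S\<close> empty or
    full.\<close>
  have zero: "(x m + y S) j mod int p = 0"
    if S: "S \<subset> {1..4}" "S \<noteq> {}" and m: "m \<in> {1..4}" and j: "j \<in> {1..<i}" for S m j
  proof (rule ccontr)
    define N where "N j \<longleftrightarrow> j \<in> {1..<i} \<and> (x 1 + y S) j mod int p \<noteq> 0" for j
    assume "(x m + y S) j mod int p \<noteq> 0"
    then have "N j" unfolding N_def using agree_sum[OF m j] j by metis
    define l where "l = (LEAST j. N j)"
    have l: "N l" unfolding l_def using \<open>N j\<close> by (rule LeastI)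
    have before: "(x 1 + y S) j mod int p = 0" if "j \<in> {1..<l}" for j
    proof -
      have "\<not> N j" using not_less_Least[of j N] that unfolding l_def[symmetric] by simp
      moreover have "j \<in> {1..<i}" using that l unfolding N_def by simp
      ultimately show ?thesis unfolding N_def by blast
    qed
    have "leading_one p n (x m + y S) \<longleftrightarrow> (x 1 + y S) l mod int p = 1" if "m \<in> {1..4}" for m
    proof -
      have lt: "l \<in> {1..<i}" using l unfolding N_def by blast
      have "leading_one p n (x m + y S) \<longleftrightarrow> (x m + y S) l mod int p = 1"
      proof (rule leading_one_iff)
        show "l \<in> {1..n}" using lt i by simp
        show "(x m + y S) j mod int p = 0" if "j \<in> {1..<l}" for j
        proof -
          have "j \<in> {1..<i}" using that lt by simp
          from agree_sum[OF \<open>m \<in> {1..4}\<close> this] before[OF that] show ?thesis by (rule trans)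
        qed
        show "(x m + y S) l mod int p \<noteq> 0"
          using l agree_sum[OF that lt] unfolding N_def by metis
      qed
      then show ?thesis using agree_sum[OF that lt] by metis
    qed
    then have all: "m \<in> S \<longleftrightarrow> (x 1 + y S) l mod int p = 1" if "m \<in> {1..4}" for m
      using sh[OF that psubset_imp_subset[OF S(1)] S(2)] that by blast
    show False
    proof (cases "(x 1 + y S) l mod int p = 1")
      case True
      then have "{1..4} \<subseteq> S" using all by blast
      then show False using S(1) by blast
    next
      case False
      then have "S \<inter> {1..4} = {}" using all by blast
      then show False using S by blast
    qed
  qed
  obtain m where m: "m \<in> {1..4}" "x m i mod int p \<noteq> x 1 i mod int p"
    using Di unfolding D_def by blast
  show False
  proof (rule shattered_residues_False[of m 1 "\<lambda>m. x m i" "int p" "\<lambda>S. y S i"])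
    fix S k assume S: "S \<subset> {1..4::nat}" and k: "k \<in> S"
    then have ne: "S \<noteq> {}" and k4: "k \<in> {1..4}" by auto
    have "leading_one p n (x k + y S)"
      using sh[OF k4 psubset_imp_subset[OF S] ne] k by blast
    then have "(x k + y S) i mod int p = 1" if "(x k + y S) i mod int p \<noteq> 0"
      using leading_one_iff[of i n "x k + y S" p, OF i zero[OF S ne k4] that] by blast
    then have "(x k + y S) i mod int p \<in> {0, 1}" by blast
    then show "(x k i + y S i) mod int p \<in> {0, 1}" by (simp only: plus_fun_apply)
  next
    fix S k assume S: "S \<subset> {1..4::nat}" "S \<noteq> {}" and k: "k \<in> {1..4} - S"
    have k4: "k \<in> {1..4}" using k by blast
    have "\<not> leading_one p n (x k + y S)"
      using sh[OF k4 psubset_imp_subset[OF S(1)] S(2)] k by blast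
    then have "(x k + y S) i mod int p \<noteq> 1"
      using i zero[OF S k4] unfolding leading_one_def by blast
    then show "(x k i + y S i) mod int p \<noteq> 1" unfolding plus_fun_apply .
  qed (use m in simp_all)
qed

lemma vc_witness_GS_le:
  assumes "p \<ge> 1" "vc_witness (Graph_of (GS p n)) k a b"
  shows "k \<le> 3"
proof (rule ccontr)
  assume "\<not> k \<le> 3"
  then have k: "{1..4} \<subseteq> {1..k}" by auto
  obtain x y where xy: "\<And>i S. i \<in> {1..k} \<Longrightarrow> S \<subseteq> {1..k} \<Longrightarrow> S \<noteq> {} \<Longrightarrow>
      leading_one p n (x i + y S) \<longleftrightarrow> i \<in> S"
    using vc_witness_sum_graph[OF assms(2)[unfolded GS_eq_sum_graph[OF assms(1)]]] by blast
  show False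
    by (rule leading_one_not_shatters_4[of p n x y]) (use xy k in blast)
qed

lemma vc_dim_property_H_GS_le:
  assumes "p \<ge> 1"
  shows "vc_dim_property (H_GS p :: 'v hgraph set) \<le> 3"
proof -
  have "vc_dim_property (H_GS p :: 'v hgraph set) \<le> enat 3"
    unfolding H_GS_def
  proof (rule vc_dim_property_closure_le)
    fix G assume "G \<in> {GS p n |n. n \<ge> 1}"
    then obtain n where G: "G = GS p n" by blast
    show "three_graph G \<and> finite (verts G)"
      unfolding G GS_eq_sum_graph[OF assms]
      by (simp add: three_graph_sum_graph finite_verts_sum_graph finite_Fp_vec)
    show "k \<le> 3" if "vc_witness (Graph_of G) k a b" for k a b
      using vc_witness_GS_le[OF assms that[unfolded G]] .
  qed
  then show ?thesis by (simp add: numeral_eq_enat)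
qed

theorem proposition2p59:
  shows "vc_dim_property (H_HP :: 'v::infinite hgraph set) = 1 \<and>
         (\<forall>p::nat. prime p \<and> p \<ge> 3 \<longrightarrow>
            vc_dim_property (H_GS p :: 'v hgraph set) \<le> 3)"
  using vc_dim_property_H_HP vc_dim_property_H_GS_le
  by (metis one_le_numeral order_trans)

end
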